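(* Let $\alpha\in\mathbb{R}$ and let $P_\alpha(X)=X^6+2X^5-(\alpha+3)X^4-2(\alpha+3)X^3+(2-\alpha)X^2+4X+1$. For $\beta\in\mathbb{R}$ let $Q_\beta(X)=X^3+(1-\beta)X^2-(2+\beta)X-1$. (i) If $\alpha<0$, then $P_\alpha$ has no real roots. (ii) If $\alpha\ge0$, then $P_\alpha=Q_{\sqrt\alpha}\,Q_{-\sqrt\alpha}$ and all roots of $P_\alpha$ are real. *)

theory Defs
  imports Complex_Main "HOL-Computational_Algebra.Polynomial"
begin

definition P_poly :: "real \<Rightarrow> real poly" where
  "P_poly \<alpha> = [:1, 4, 2 - \<alpha>, - 2 * (\<alpha> + 3), - (\<alpha> + 3), 2, 1:]"

definition Q_poly :: "real \<Rightarrow> real poly" where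
  "Q_poly \<beta> = [:-1, - (2 + \<beta>), 1 - \<beta>, 1:]"

end

theory Submission
  imports Defs
begin

text \<open>
  Put \<open>A = X\<^sup>3 + X\<^sup>2 - 2X - 1\<close> and \<open>B = X\<^sup>2 + X\<close>. Then \<open>Q\<^sub>\<beta> = A - \<beta>B\<close> and
  \<open>P\<^sub>\<alpha> = A\<^sup>2 - \<alpha>B\<^sup>2\<close>, and \<open>A\<close> does not vanish at the zeros \<open>0\<close>, \<open>-1\<close> of \<open>B\<close>. Hence
  \<open>P\<^sub>\<alpha>\<close> is positive on the real line if \<open>\<alpha> < 0\<close>. If \<open>\<alpha> \<ge> 0\<close>, every root \<open>z\<close> of \<open>P\<^sub>\<alpha>\<close>
  satisfies \<open>A(z)/B(z) = \<plusminus>\<surd>\<alpha>\<close>; as \<open>A/B = X - 1/X - 1/(X + 1)\<close> maps the open upper and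
  lower half planes to themselves, \<open>z\<close> is real.
\<close>

lemma poly_P_poly:
  "poly (P_poly \<alpha>) x = (x^3 + x^2 - 2 * x - 1)\<^sup>2 - \<alpha> * (x^2 + x)\<^sup>2"
  by (simp add: P_poly_def) algebra

lemma poly_P_poly_complex:
  fixes z :: complex
  shows "poly (map_poly of_real (P_poly \<alpha>)) z =
    (z^3 + z^2 - 2 * z - 1)\<^sup>2 - of_real \<alpha> * (z^2 + z)\<^sup>2"
  by (simp add: P_poly_def map_poly_pCons) algebra

lemma P_poly_eq_Q_poly_mult:
  assumes "\<alpha> \<ge> 0"
  shows "P_poly \<alpha> = Q_poly (sqrt \<alpha>) * Q_poly (- sqrt \<alpha>)"
proof -
  define s where "s = sqrt \<alpha>"
  have "\<alpha> = s * s"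
    using assms by (simp add: s_def)
  then show ?thesis
    by (simp add: P_poly_def Q_poly_def algebra_simps flip: s_def)
qed

lemma P_poly_neg_no_real_root:
  assumes "\<alpha> < 0"
  shows "poly (P_poly \<alpha>) x \<noteq> 0"
proof
  assume "poly (P_poly \<alpha>) x = 0"
  then have root: "(x^3 + x^2 - 2 * x - 1)\<^sup>2 + (- \<alpha>) * (x^2 + x)\<^sup>2 = 0"
    by (simp add: poly_P_poly)
  moreover have "(- \<alpha>) * (x^2 + x)\<^sup>2 \<ge> 0"
    using assms by (intro mult_nonneg_nonneg) auto
  ultimately have "(x^3 + x^2 - 2 * x - 1)\<^sup>2 = 0" "(- \<alpha>) * (x^2 + x)\<^sup>2 = 0"
    by (smt (verit) zero_le_power2)+
  then have A: "x^3 + x^2 - 2 * x - 1 = 0" and "x^2 + x = 0"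
    using assms by simp_all
  then have "x * (x + 1) = 0"
    by (simp add: power2_eq_square distrib_left)
  then have "x = 0 \<or> x = -1"
    by (simp add: eq_neg_iff_add_eq_0)
  with A show False
    by auto
qed

lemma Im_inverse_eq: "Im (1 / z) = - (Im z / (cmod z)\<^sup>2)"
  by (simp add: Im_divide cmod_power2)

lemma real_of_partial_fractions_real:
  fixes z :: complex
  assumes "z - 1 / z - 1 / (z + 1) \<in> \<real>"
  shows "z \<in> \<real>"
proof -
  have "Im z * (1 + 1 / (cmod z)\<^sup>2 + 1 / (cmod (z + 1))\<^sup>2) = Im (z - 1 / z - 1 / (z + 1))"
    by (simp add: Im_inverse_eq algebra_simps)
  also have "\<dots> = 0"
    using assms by (simp add: complex_is_Real_iff)
  finally have "Im z * (1 + 1 / (cmod z)\<^sup>2 + 1 / (cmod (z + 1))\<^sup>2) = 0" .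
  moreover have "1 + 1 / (cmod z)\<^sup>2 + 1 / (cmod (z + 1))\<^sup>2 > 0"
    by (intro add_pos_nonneg) auto
  ultimately show ?thesis
    by (simp add: complex_is_Real_iff)
qed

lemma P_poly_nonneg_roots_real:
  fixes z :: complex
  assumes "\<alpha> \<ge> 0" and root: "poly (map_poly of_real (P_poly \<alpha>)) z = 0"
  shows "z \<in> \<real>"
proof (cases "z = 0 \<or> z + 1 = 0")
  case True
  then show ?thesis
    by (auto simp: add_eq_0_iff2)
next
  case False
  then have nz: "z \<noteq> 0" "z + 1 \<noteq> 0" by auto
  define s where "s = complex_of_real (sqrt \<alpha>)"
  have "of_real \<alpha> = s\<^sup>2"
    using assms(1) by (simp add: s_def flip: of_real_power)
  with root have "(z^3 + z^2 - 2 * z - 1)\<^sup>2 = (s * (z^2 + z))\<^sup>2"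
    by (simp add: poly_P_poly_complex power_mult_distrib)
  then have "z^3 + z^2 - 2 * z - 1 = s * (z^2 + z) \<or> z^3 + z^2 - 2 * z - 1 = - s * (z^2 + z)"
    by (simp add: power2_eq_iff)
  moreover have "z^3 + z^2 - 2 * z - 1 = (z - 1 / z - 1 / (z + 1)) * (z^2 + z)"
  proof -
    have "1 / z * (z^2 + z) = z + 1" "1 / (z + 1) * (z^2 + z) = z"
      using nz by (simp_all add: field_simps power2_eq_square)
    then show ?thesis
      by (simp add: left_diff_distrib) (simp add: algebra_simps power2_eq_square power3_eq_cube)
  qed
  moreover have "z^2 + z \<noteq> 0"
    using nz by (metis mult_eq_0_iff distrib_left mult.right_neutral power2_eq_square)
  ultimately have "z - 1 / z - 1 / (z + 1) = s \<or> z - 1 / z - 1 / (z + 1) = - s"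
    by (metis mult_cancel_right)
  then have "z - 1 / z - 1 / (z + 1) \<in> \<real>"
    by (auto simp: s_def)
  then show ?thesis
    by (rule real_of_partial_fractions_real)
qed

theorem lemmaA2:
  fixes \<alpha> :: real
  shows "(\<alpha> < 0 \<longrightarrow> (\<forall>x::real. poly (P_poly \<alpha>) x \<noteq> 0)) \<and>
         (\<alpha> \<ge> 0 \<longrightarrow>
            P_poly \<alpha> = Q_poly (sqrt \<alpha>) * Q_poly (- sqrt \<alpha>) \<and>
            (\<forall>z::complex. poly (map_poly of_real (P_poly \<alpha>)) z = 0 \<longrightarrow> z \<in> \<real>))"
  using P_poly_neg_no_real_root P_poly_eq_Q_poly_mult P_poly_nonneg_roots_real by blast

end
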